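(* Let $s,k\in\mathbb{N}$ with $s\geq k(k+1)$, let $\epsilon$ be a sufficiently small positive real number, and let $\Lambda$ be as defined in the context. Let $A\subseteq\mathbb{Z}$ be a non-empty finite set with $|A|$ large enough, and let $\alpha\leq 1$ be any (positive) real number such that \[ \log{\alpha^{-1}} \leq \frac{\epsilon(k(k+1)-2\Lambda)}{43200}\log{|A|} \quad\text{and}\quad J_{s,k}(A) = \alpha|A|^{2s-k(k+1)/2+\Lambda}. \] Then there exists $A'\subseteq A$ with $|A'|\geq\alpha^{\epsilon/4}|A|^{1-\epsilon k^2}$ such that for all $l\in\mathbb{N}$, \[ |l\mathscr{A'}| \leq \alpha^{-(1+2\epsilon(l+k^2))}|A'|^{(\frac{k(k+1)}{2}-\Lambda)(1+\epsilon(l+k^2))}, \] where $\mathscr{A'}=\{(a,a^2,\dots,a^k): a\in A'\}$.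
   Context: For a finite set $A$ and natural numbers $s,k$, $J_{s,k}(A)$ denotes the number of solutions $(x_1,\dots,x_s,y_1,\dots,y_s)\in A^{2s}$ of the system $\sum_{i=1}^s x_i^j = \sum_{i=1}^s y_i^j$ for $1\le j\le k$. Let $\mathcal{U}\subseteq\mathbb{R}$ be the set of all $\lambda$ such that $J_{s,k}(A)\le |A|^{2s-k(k+1)/2}|A|^{\lambda}$ for all $(s,k)\in\mathbb{N}^2$ with $s\ge k(k+1)/2$ and all finite non-empty $A\subseteq\mathbb{Z}$ with $|A|$ large enough with respect to $\lambda,s,k$; and $\Lambda=\inf\mathcal{U}$. For $\mathscr{B}\subseteq\mathbb{R}^k$, $l\mathscr{B}=\{b_1+\dots+b_l : b_i\in\mathscr{B}\}$. *)

theory Defs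
  imports Complex_Main "HOL-Library.FuncSet" "HOL-Library.Function_Algebras"
    "HOL-Library.Extended_Real"
begin

definition J :: "nat \<Rightarrow> nat \<Rightarrow> int set \<Rightarrow> nat" where
  "J s k A = card {(x, y) \<in> ({1..s} \<rightarrow>\<^sub>E A) \<times> ({1..s} \<rightarrow>\<^sub>E A).
                \<forall>j\<in>{1..k}. (\<Sum>i=1..s. x i ^ j) = (\<Sum>i=1..s. y i ^ j)}"

definition admissible_exponents :: "real set" where
  "admissible_exponents =
     {t. \<forall>s k :: nat. 1 \<le> s \<and> 1 \<le> k \<and> real s \<ge> real k * (real k + 1) / 2 \<longrightarrow>
        (\<exists>N. \<forall>A :: int set. finite A \<and> A \<noteq> {} \<and> N \<le> card A \<longrightarrow>
           real (J s k A) \<le>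
             real (card A) powr (2 * real s - real k * (real k + 1) / 2) * real (card A) powr t)}"

text \<open>The infimum is taken in the extended reals, so that it is \<open>\<infinity>\<close> if no exponent is admissible;
  on type \<^typ>\<open>real\<close> the infimum of the empty set would be an unspecified number.\<close>

definition Lambda :: ereal where
  "Lambda = Inf (ereal ` admissible_exponents)"

text \<open>A vector \<open>(v\<^sub>1, \<dots>, v\<^sub>k)\<close> of \<open>k\<close>-dimensional real space is represented by the function that maps
  \<open>j \<in> {1..k}\<close> to \<open>v\<^sub>j\<close> and every other index to \<open>0\<close>; addition is pointwise.\<close>

definition moment_curve :: "nat \<Rightarrow> int set \<Rightarrow> (nat \<Rightarrow> real) set" where
  "moment_curve k A = (\<lambda>a j. if j \<in> {1..k} then real_of_int a ^ j else 0) ` A"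

definition iterated_sumset :: "nat \<Rightarrow> 'a::comm_monoid_add set \<Rightarrow> 'a set" where
  "iterated_sumset l B = {\<Sum>i=1..l. b i | b. \<forall>i\<in>{1..l}. b i \<in> B}"

end

theory Submission
  imports Defs "HOL-Library.Set_Algebras"
begin

text \<open>
  Put \<open>K = k (k + 1) / 2\<close>, \<open>D = K - \<Lambda>\<close> and \<open>\<delta> = \<epsilon> D / 21600\<close>, and write \<open>n\<close> for the size of \<open>A\<close>.
  The hypothesis on \<open>\<alpha>\<close> says \<open>\<alpha> \<ge> n powr -\<delta>\<close>; as \<open>s \<ge> 2 K\<close>, dropping variables
  gives \<open>J\<^sub>2\<^sub>K \<ge> n powr (4 K - D - \<delta>)\<close>, while the definition of \<open>\<Lambda>\<close> gives
  \<open>J\<^sub>K \<le> n powr (2 K - D + \<delta>)\<close>. So the distribution of sums of \<open>K\<close> points of the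
  moment curve has, up to factors \<open>n powr O(\<delta>)\<close>, the additive energy of the uniform
  distribution on a group of size \<open>n powr D\<close>. A Balog--Szemeredi--Gowers argument on
  \<open>K\<close>-tuples yields a dense set of tuples whose sums have small difference set, and one of its
  fibres over the last \<open>K - 1\<close> coordinates is \<open>A'\<close>. Petridis' form of Pluennecke's inequality
  then bounds all iterated sumsets. The total loss is \<open>n powr ((29 l + 24) \<delta>)\<close>, well below
  \<open>n powr (\<epsilon> D l) = n powr (21600 l \<delta>)\<close>.
\<close>

section \<open>Pluennecke's inequality\<close>

text \<open>Induction on \<open>C\<close>. A new element \<open>c\<close> adds exactly |X| - |Y|
  points to \<open>X + C\<close>, where \<open>Y\<close> collects the x with x + c already present,
  and at most |X + B| - |Y + B| points to \<open>X + B + C\<close>. Assumption \<open>X\<close>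
  together with \<open>min\<close> at \<open>Y\<close> bounds the second gain by \<kappa> times the
  first.\<close>

lemma petridis_step:
  fixes X B C :: "'a::ab_group_add set" and \<kappa> :: real
  assumes fin: "finite X" "finite B" "finite C"
    and X: "real (card (X + B)) \<le> \<kappa> * card X"
    and min: "\<And>Y. Y \<subseteq> X \<Longrightarrow> \<kappa> * card Y \<le> real (card (Y + B))"
  shows "real (card (X + B + C)) \<le> \<kappa> * card (X + C)"
  using fin(3)
proof (induction C rule: finite_induct)
  case empty
  then show ?case by (simp add: set_plus_def)
next
  case (insert c C)
  define Y where "Y = {x \<in> X. x + c \<in> X + C}"
  have Y: "Y \<subseteq> X" "finite Y" using fin by (auto simp: Y_def)
  let ?t = "\<lambda>x. x + c"
  have inj: "inj_on ?t S" for S by (auto simp: inj_on_def)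
  have "X + insert c C = (X + C) \<union> ?t ` (X - Y)"
    by (auto simp: Y_def set_plus_def image_iff)
  moreover have "(X + C) \<inter> ?t ` (X - Y) = {}"
    by (auto simp: Y_def)
  ultimately have "card (X + insert c C) = card (X + C) + (card X - card Y)"
    using fin Y insert.hyps
    by (simp add: card_Un_disjoint card_image[OF inj] card_Diff_subset finite_set_plus)
  then have 1: "real (card (X + insert c C)) = card (X + C) + real (card X) - card Y"
    using card_mono[OF fin(1) Y(1)] by simp
  have YB: "Y + B \<subseteq> X + B" using Y by (auto simp: set_plus_def)
  \<comment> \<open>Translates \<open>Y + B + c\<close> are already contained in \<open>X + B + C\<close>.\<close>
  have "X + B + insert c C \<subseteq> (X + B + C) \<union> ?t ` ((X + B) - (Y + B))"
  proof
    fix z assume "z \<in> X + B + insert c C"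
    then obtain x b d where z: "z = x + b + d" "x \<in> X" "b \<in> B" "d \<in> insert c C"
      by (auto simp: set_plus_def)
    show "z \<in> (X + B + C) \<union> ?t ` ((X + B) - (Y + B))"
    proof (cases "d = c \<and> x + b \<notin> Y + B")
      case True
      then show ?thesis using z by blast
    next
      case False
      show ?thesis
      proof (cases "d = c")
        case True
        with False obtain y b' where y: "x + b = y + b'" "y \<in> Y" "b' \<in> B"
          by (auto simp: set_plus_def)
        from y(2) obtain x' c' where "y + c = x' + c'" "x' \<in> X" "c' \<in> C"
          by (auto simp: Y_def set_plus_def)
        moreover have "z = y + c + b'" using z True y by (simp add: algebra_simps)
        ultimately have "z = x' + b' + c'" by (simp add: algebra_simps)
        then show ?thesis using \<open>x' \<in> X\<close> \<open>c' \<in> C\<close> y by (auto intro!: set_plus_intro)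
      next
        case False
        then show ?thesis using z by (auto intro!: set_plus_intro)
      qed
    qed
  qed
  then have "card (X + B + insert c C) \<le> card ((X + B + C) \<union> ?t ` ((X + B) - (Y + B)))"
    using fin insert.hyps by (intro card_mono) (auto simp: finite_set_plus)
  also have "\<dots> \<le> card (X + B + C) + card (?t ` ((X + B) - (Y + B)))"
    by (rule card_Un_le)
  also have "card (?t ` ((X + B) - (Y + B))) = card (X + B) - card (Y + B)"
    using fin Y YB by (simp add: card_image[OF inj] card_Diff_subset finite_set_plus)
  finally have "real (card (X + B + insert c C)) \<le> card (X + B + C) + real (card (X + B)) - card (Y + B)"
    using card_mono[OF _ YB] fin by (simp add: finite_set_plus)
  also have "\<dots> \<le> \<kappa> * card (X + C) + \<kappa> * card X - \<kappa> * card Y"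
    using insert.IH X min[OF Y(1)] by linarith
  also have "\<dots> = \<kappa> * card (X + insert c C)"
    unfolding 1 by (simp add: algebra_simps)
  finally show ?case .
qed

section \<open>Iterated sumsets and their growth\<close>

lemma iterated_sumset_0 [simp]: "iterated_sumset 0 B = {0}"
  by (auto simp: iterated_sumset_def)

lemma iterated_sumset_Suc: "iterated_sumset (Suc l) B = B + iterated_sumset l B"
proof
  show "iterated_sumset (Suc l) B \<subseteq> B + iterated_sumset l B"
  proof
    fix z assume "z \<in> iterated_sumset (Suc l) B"
    then obtain b where b: "z = (\<Sum>i=1..Suc l. b i)" "\<forall>i\<in>{1..Suc l}. b i \<in> B"
      by (auto simp: iterated_sumset_def)
    then have "z = b (Suc l) + (\<Sum>i=1..l. b i)" by (simp add: add.commute)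
    moreover have "(\<Sum>i=1..l. b i) \<in> iterated_sumset l B"
      using b by (force simp: iterated_sumset_def)
    ultimately show "z \<in> B + iterated_sumset l B" using b(2) by (auto intro: set_plus_intro)
  qed
  show "B + iterated_sumset l B \<subseteq> iterated_sumset (Suc l) B"
  proof
    fix z assume "z \<in> B + iterated_sumset l B"
    then obtain c b where b: "z = c + (\<Sum>i=1..l. b i)" "c \<in> B" "\<forall>i\<in>{1..l}. b i \<in> B"
      by (auto simp: iterated_sumset_def set_plus_def)
    define b' where "b' = b(Suc l := c)"
    have "z = (\<Sum>i=1..Suc l. b' i)" using b by (simp add: b'_def add.commute)
    moreover have "\<forall>i\<in>{1..Suc l}. b' i \<in> B" using b by (auto simp: b'_def)
    ultimately show "z \<in> iterated_sumset (Suc l) B" unfolding iterated_sumset_def by blast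
  qed
qed

lemma finite_iterated_sumset: "finite B \<Longrightarrow> finite (iterated_sumset l B)"
  by (induction l) (auto simp: iterated_sumset_Suc finite_set_plus)

text \<open>Transfers a bound for sums of negated points, which a difference set provides, to the
  points themselves.\<close>

lemma iterated_sumset_uminus:
  fixes B :: "'a::ab_group_add set"
  shows "iterated_sumset l (uminus ` B) = uminus ` iterated_sumset l B"
proof (induction l)
  case (Suc l)
  have "uminus ` S + uminus ` T = uminus ` (S + T)" for S T :: "'a set"
    by (force simp: set_plus_def image_iff)
  then show ?case by (simp add: iterated_sumset_Suc Suc.IH)
qed simp

text \<open>A non-empty \<open>X\<close> inside \<open>H\<close> that minimises |X + B| / |X|
  satisfies the assumptions of \<open>petridis_step\<close> with its own ratio, so each further copy
  of \<open>B\<close> multiplies the size of the sumset by at most that ratio. The ratio is at most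
  \<kappa> because \<open>H\<close> itself competes.\<close>

lemma plunnecke:
  fixes H B :: "'a::ab_group_add set" and \<kappa> :: real
  assumes fin: "finite H" "finite B" and H: "H \<noteq> {}"
    and le: "real (card (H + B)) \<le> \<kappa> * card H"
  shows "real (card (iterated_sumset l B)) \<le> \<kappa> ^ l * card H"
proof -
  let ?P = "{X. X \<subseteq> H \<and> X \<noteq> {}}"
  let ?q = "\<lambda>X. real (card (X + B)) / card X"
  have "finite ?P" "?P \<noteq> {}" using fin H by auto
  then obtain X where X: "X \<in> ?P" and Xmin: "\<And>Y. Y \<in> ?P \<Longrightarrow> ?q X \<le> ?q Y"
    using arg_min_if_finite[of ?P ?q] by (metis (no_types, lifting) linorder_not_less)
  define \<mu> where "\<mu> = ?q X"
  have fX: "finite X" "card X > 0" using X fin by (auto simp: card_gt_0_iff finite_subset)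
  have "0 < card H" using fin H by (simp add: card_gt_0_iff)
  then have "?q H \<le> \<kappa>" using le by (simp add: field_simps)
  then have mu: "0 \<le> \<mu>" "\<mu> \<le> \<kappa>"
    using Xmin[of H] H unfolding \<mu>_def by auto
  have eq: "real (card (X + B)) = \<mu> * card X" using fX by (simp add: \<mu>_def)
  have min: "\<mu> * card Y \<le> real (card (Y + B))" if "Y \<subseteq> X" for Y
  proof (cases "Y = {}")
    case False
    then have "Y \<in> ?P" "card Y > 0" using that X fX by (auto simp: card_gt_0_iff finite_subset)
    then show ?thesis using Xmin[of Y] by (simp add: \<mu>_def field_simps)
  qed simp
  have "real (card (X + iterated_sumset l B)) \<le> \<mu> ^ l * card X"
  proof (induction l)
    case (Suc l)
    have "real (card (X + iterated_sumset (Suc l) B)) \<le> \<mu> * card (X + iterated_sumset l B)"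
      using petridis_step[OF fX(1) fin(2) finite_iterated_sumset[OF fin(2), of l] eq_refl[OF eq] min]
      by (simp add: iterated_sumset_Suc add.assoc)
    also have "\<dots> \<le> \<mu> * (\<mu> ^ l * card X)" using Suc mu by (intro mult_left_mono)
    finally show ?case by simp
  qed (simp add: set_plus_def)
  also have "\<dots> \<le> \<kappa> ^ l * card H"
    using mu X fin by (intro mult_mono power_mono) (auto intro: card_mono)
  finally have 1: "real (card (X + iterated_sumset l B)) \<le> \<kappa> ^ l * card H" .
  \<comment> \<open>A translate of the iterated sumset by one point of \<open>X\<close> already lies
    in the set just bounded.\<close>
  obtain x where "x \<in> X" using X by auto
  then have "card ((+) x ` iterated_sumset l B) \<le> card (X + iterated_sumset l B)"
    using fX fin by (intro card_mono) (auto simp: finite_set_plus finite_iterated_sumset intro: set_plus_intro)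
  also have "card ((+) x ` iterated_sumset l B) = card (iterated_sumset l B)"
    by (rule card_image) (auto simp: inj_on_def)
  finally show ?thesis using 1 by linarith
qed

section \<open>Dependent random choice\<close>

lemma card_pairs: "finite V \<Longrightarrow> card {(u, v) \<in> V \<times> V. P u v} = (\<Sum>u\<in>V. card {v \<in> V. P u v})"
proof -
  assume "finite V"
  have "{(u, v) \<in> V \<times> V. P u v} = (SIGMA u:V. {v \<in> V. P u v})" by auto
  then show ?thesis using \<open>finite V\<close> by (simp add: card_SigmaI)
qed

text \<open>The neighbourhood of an average vertex \<open>w\<close> is large by a second moment
  bound, while a pair with few common neighbours seldom lies in it. Deleting neighbours with many
  bad partners leaves \<open>U\<close>, any two points of which are joined by many paths of length
  four. \<open>N\<close> merely bounds |V| because the application restricts the vertices but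
  measures density against the full set.\<close>

lemma dependent_random_choice:
  fixes V :: "'v set" and N \<rho> :: real
  assumes fin: "finite V" and N: "card V \<le> N" "N > 0" and rho: "\<rho> > 0"
    and edges: "\<rho> * N ^ 2 \<le> card {(u, w) \<in> V \<times> V. E u w}"
  defines "good \<equiv> \<lambda>u v. \<rho>^2 / 16 * N \<le> card {w \<in> V. E u w \<and> E v w}"
  obtains U where "U \<subseteq> V" "\<rho> / 4 * N \<le> card U"
    "\<And>u v. u \<in> U \<Longrightarrow> v \<in> U \<Longrightarrow> \<exists>W\<subseteq>V. \<rho> / 4 * N \<le> card W \<and> (\<forall>w\<in>W. good u w \<and> good w v)"
proof -
  define nb where "nb w = {u \<in> V. E u w}" for w
  define bad where "bad w = {(u, v) \<in> nb w \<times> nb w. \<not> good u v}" for w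
  have fnb: "finite (nb w)" "nb w \<subseteq> V" for w using fin by (auto simp: nb_def)
  have "card {(u, w) \<in> V \<times> V. E u w} = card {(w, u) \<in> V \<times> V. E u w}"
    by (intro bij_betw_same_card[of prod.swap] bij_betwI[where g = prod.swap]) auto
  also have "\<dots> = (\<Sum>w\<in>V. card (nb w))"
    unfolding nb_def by (rule card_pairs[OF fin])
  finally have deg: "\<rho> * N ^ 2 \<le> (\<Sum>w\<in>V. real (card (nb w)))" using edges by simp
  \<comment> \<open>The tangent inequality 2 c t - c^2 \<le> t^2 at c = \<open>\<rho> * N\<close>,
    summed over \<open>V\<close>, plays the part of Cauchy-Schwarz.\<close>
  have "2 * \<rho> * N * (\<rho> * N^2) - (\<rho> * N)^2 * N
      \<le> 2 * \<rho> * N * (\<Sum>w\<in>V. real (card (nb w))) - (\<rho> * N)^2 * card V"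
    using deg rho N by (intro diff_mono mult_left_mono) auto
  also have "\<dots> = (\<Sum>w\<in>V. 2 * \<rho> * N * real (card (nb w)) - (\<rho> * N)^2)"
    by (simp add: sum_subtractf sum_distrib_left)
  also have "\<dots> \<le> (\<Sum>w\<in>V. (real (card (nb w)))\<^sup>2)"
  proof (rule sum_mono)
    fix w
    show "2 * \<rho> * N * real (card (nb w)) - (\<rho> * N)^2 \<le> (real (card (nb w)))\<^sup>2"
      using zero_le_power2[of "real (card (nb w)) - \<rho> * N"] by (simp add: power2_diff mult_ac)
  qed
  finally have sq: "\<rho>^2 * N ^ 3 \<le> (\<Sum>w\<in>V. (real (card (nb w)))\<^sup>2)"
    by (simp add: power2_eq_square power3_eq_cube algebra_simps)
  have fbad: "finite (bad w)" for w
    using fin fnb by (intro finite_subset[of "bad w" "V \<times> V"]) (auto simp: bad_def)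
  have fB: "finite {(u, v) \<in> V \<times> V. \<not> good u v}"
    by (rule finite_subset[of _ "V \<times> V", rotated]) (auto simp: fin)
  \<comment> \<open>Double counting: each of the at most N^2 bad pairs lies in fewer than \<rho>^2 N
    / 16 neighbourhoods.\<close>
  have "(\<Sum>w\<in>V. card (bad w)) = card (SIGMA w:V. bad w)"
    using fin fbad by simp
  also have "\<dots> = card (SIGMA p:{(u, v) \<in> V \<times> V. \<not> good u v}. {w \<in> V. E (fst p) w \<and> E (snd p) w})"
    by (intro bij_betw_same_card[of prod.swap] bij_betwI[where g = prod.swap])
       (auto simp: bad_def nb_def)
  also have "\<dots> = (\<Sum>p\<in>{(u, v) \<in> V \<times> V. \<not> good u v}. card {w \<in> V. E (fst p) w \<and> E (snd p) w})"
    using fin fB by simp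
  also have "real \<dots> \<le> (\<Sum>p\<in>{(u, v) \<in> V \<times> V. \<not> good u v}. \<rho>^2 / 16 * N)"
    unfolding of_nat_sum by (intro sum_mono) (auto simp: good_def)
  also have "\<dots> \<le> N^2 * (\<rho>^2 / 16 * N)"
  proof -
    have "card {(u, v) \<in> V \<times> V. \<not> good u v} \<le> card (V \<times> V)"
      using fin by (intro card_mono) auto
    then have "real (card {(u, v) \<in> V \<times> V. \<not> good u v}) \<le> real (card V) * real (card V)"
      by (simp add: card_cartesian_product flip: of_nat_mult)
    also have "\<dots> \<le> N * N" using N by (intro mult_mono) auto
    finally show ?thesis using N unfolding power2_eq_square by (simp add: mult_right_mono)
  qed
  finally have badle: "real (\<Sum>w\<in>V. card (bad w)) \<le> \<rho>^2 * N^3 / 16"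
    by (simp add: power2_eq_square power3_eq_cube mult_ac)
  \<comment> \<open>With weight 8 the bad pairs cost at most half of \<rho>^2 N^3, so the right-hand
    sides sum to at least \<rho>^2 N^3 / 2 over at most N vertices.\<close>
  have "\<exists>w\<in>V. \<rho>^2 * N^2 / 2 \<le> (real (card (nb w)))\<^sup>2 - 8 * card (bad w)"
  proof (rule ccontr)
    assume "\<not> ?thesis"
    then have ne: "\<And>w. w \<in> V \<Longrightarrow> (real (card (nb w)))\<^sup>2 - 8 * card (bad w) < \<rho>^2 * N^2 / 2"
      by auto
    have "V \<noteq> {}"
    proof
      assume "V = {}"
      then have "\<rho> * N^2 \<le> 0" using edges by simp
      then show False using rho N by (simp add: mult_le_0_iff)
    qed
    then have "(\<Sum>w\<in>V. (real (card (nb w)))\<^sup>2 - 8 * card (bad w)) < (\<Sum>w\<in>V. \<rho>^2 * N^2 / 2)"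
      using ne fin by (intro sum_strict_mono) auto
    also have "\<dots> \<le> N * (\<rho>^2 * N^2 / 2)" using N by (simp add: mult_right_mono)
    finally have "(\<Sum>w\<in>V. (real (card (nb w)))\<^sup>2) - 8 * real (\<Sum>w\<in>V. card (bad w)) < \<rho>^2 * N^3 / 2"
      by (simp add: sum_subtractf sum_distrib_left power2_eq_square power3_eq_cube mult_ac)
    with sq badle show False by linarith
  qed
  then obtain w where w: "w \<in> V" and wle: "\<rho>^2 * N^2 / 2 \<le> (real (card (nb w)))\<^sup>2 - 8 * card (bad w)"
    by blast
  define c where "c = real (card (nb w))"
  have "\<rho>^2 * N^2 / 4 \<le> c\<^sup>2"
    using wle zero_le_power2[of c] unfolding c_def by linarith
  then have "(\<rho> * N / 2)\<^sup>2 \<le> c\<^sup>2"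
    by (simp add: power_mult_distrib power_divide)
  then have c: "\<rho> * N / 2 \<le> c" by (rule power2_le_imp_le) (simp add: c_def)
  have cpos: "c > 0" using c rho N by (smt (verit) divide_pos_pos mult_pos_pos)
  have badw: "8 * real (card (bad w)) \<le> c\<^sup>2"
  proof -
    have "0 \<le> \<rho>^2 * N^2" by simp
    with wle show ?thesis unfolding c_def by linarith
  qed
  \<comment> \<open>By Markov at most (c^2 / 8) / (c / 4) = c / 2 neighbours of \<open>w\<close>
    have more than c / 4 bad partners, so \<open>U\<close> keeps at least half of the
    neighbourhood.\<close>
  define ba where "ba u = {v \<in> nb w. \<not> good u v}" for u
  define U where "U = {u \<in> nb w. card (ba u) \<le> c / 4}"
  have "(\<Sum>u\<in>nb w - U. c / 4) \<le> (\<Sum>u\<in>nb w - U. real (card (ba u)))"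
    by (intro sum_mono) (auto simp: U_def)
  also have "\<dots> \<le> (\<Sum>u\<in>nb w. real (card (ba u)))"
    using fnb by (intro sum_mono2) auto
  also have "\<dots> = card (bad w)"
    using card_pairs[OF fnb(1), of w "\<lambda>u v. \<not> good u v"] by (simp add: bad_def ba_def)
  also have "\<dots> \<le> c * c / 8" using badw by (simp add: power2_eq_square)
  finally have "card (nb w - U) * (c / 4) \<le> (c / 2) * (c / 4)" by simp
  then have "card (nb w - U) \<le> c / 2" using cpos by (simp only: mult_le_cancel_right_pos divide_pos_pos zero_less_numeral)
  moreover have "card (nb w - U) = card (nb w) - card U" "card U \<le> card (nb w)"
    using fnb by (auto simp: card_Diff_subset U_def finite_subset intro!: card_mono)
  ultimately have cU: "c / 2 \<le> card U" by (simp add: c_def)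
  have "\<exists>W\<subseteq>V. \<rho> / 4 * N \<le> card W \<and> (\<forall>x\<in>W. good u x \<and> good x v)" if "u \<in> U" "v \<in> U" for u v
  proof (intro exI conjI)
    \<comment> \<open>Being bad for \<open>u\<close> or for \<open>v\<close> excludes at most c / 4
      + c / 4 neighbours; c / 2 \<ge> \<rho> N / 4 remain.\<close>
    let ?W = "nb w - (ba u \<union> ba v)"
    show "?W \<subseteq> V" using fnb by auto
    have sub: "ba u \<union> ba v \<subseteq> nb w" by (auto simp: ba_def)
    have "card (ba u \<union> ba v) \<le> card (ba u) + card (ba v)" by (rule card_Un_le)
    then have "real (card (ba u \<union> ba v)) \<le> c / 2" using that by (simp add: U_def)
    moreover have "card ?W = card (nb w) - card (ba u \<union> ba v)" "card (ba u \<union> ba v) \<le> card (nb w)"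
      using fnb sub by (auto simp: card_Diff_subset finite_subset intro!: card_mono)
    ultimately show "\<rho> / 4 * N \<le> card ?W" using c by (simp add: c_def)
    have "good x v \<longleftrightarrow> good v x" for x by (simp add: good_def conj_commute)
    then show "\<forall>x\<in>?W. good u x \<and> good x v" by (auto simp: ba_def)
  qed
  moreover have "U \<subseteq> V" "\<rho> / 4 * N \<le> card U" using fnb cU c by (auto simp: U_def)
  ultimately show thesis using that by blast
qed

section \<open>The Balog--Szemeredi--Gowers theorem for weighted sums\<close>

definition reps :: "('v \<Rightarrow> 'a) \<Rightarrow> 'v set \<Rightarrow> 'a \<Rightarrow> 'v set" where
  "reps f V x = {v \<in> V. f v = x}"

lemma finite_reps [simp]: "finite V \<Longrightarrow> finite (reps f V x)"
  by (simp add: reps_def)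

lemma sum_card_reps:
  assumes "finite V" "finite X"
  shows "(\<Sum>x\<in>X. card (reps f V x)) \<le> card V"
proof -
  have "(\<Sum>x\<in>X. card (reps f V x)) = card (\<Union>x\<in>X. reps f V x)"
    using assms by (intro card_UN_disjoint[symmetric]) (auto simp: reps_def)
  also have "\<dots> \<le> card V" using assms by (intro card_mono) (auto simp: reps_def)
  finally show ?thesis .
qed

lemma card_le_fibre_times_image:
  assumes "finite C" "\<And>x. x \<in> f ` C \<Longrightarrow> real (card (reps f C x)) \<le> T"
  shows "real (card C) \<le> T * card (f ` C)"
proof -
  have "C = (\<Union>x\<in>f ` C. reps f C x)" by (auto simp: reps_def)
  then have "card C = card (\<Union>x\<in>f ` C. reps f C x)" by simp
  also have "\<dots> \<le> (\<Sum>x\<in>f ` C. card (reps f C x))" using assms by (intro card_UN_le) auto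
  also have "real \<dots> \<le> (\<Sum>x\<in>f ` C. T)" unfolding of_nat_sum using assms by (intro sum_mono)
  finally show ?thesis by (simp add: mult.commute)
qed

text \<open>Every x in \<open>X\<close> splits d as x + (d - x), and distinct x yield disjoint
  families of pairs. Used twice below to count representations along paths of length two and then
  four.\<close>

lemma card_reps_add_ge:
  fixes f :: "'v \<Rightarrow> 'a::ab_group_add" and g :: "'w \<Rightarrow> 'a" and m1 m2 :: real
  assumes "finite V" "finite W" "finite X" "0 \<le> m1" "0 \<le> m2"
    and "\<And>x. x \<in> X \<Longrightarrow> m1 \<le> card (reps f V x)"
    and "\<And>x. x \<in> X \<Longrightarrow> m2 \<le> card (reps g W (d - x))"
  shows "card X * (m1 * m2) \<le> card (reps (\<lambda>(v, w). f v + g w) (V \<times> W) d)"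
proof -
  have "card X * (m1 * m2) = (\<Sum>x\<in>X. m1 * m2)" by simp
  also have "\<dots> \<le> (\<Sum>x\<in>X. real (card (reps f V x \<times> reps g W (d - x))))"
    unfolding card_cartesian_product of_nat_mult using assms by (intro sum_mono mult_mono) auto
  also have "\<dots> = card (\<Union>x\<in>X. reps f V x \<times> reps g W (d - x))"
    unfolding of_nat_sum[symmetric] using assms
    by (intro arg_cong[where f = real] card_UN_disjoint[symmetric]) (auto simp: reps_def)
  also have "\<dots> \<le> card (reps (\<lambda>(v, w). f v + g w) (V \<times> W) d)"
    using assms by (intro of_nat_mono card_mono) (auto simp: reps_def)
  finally show ?thesis .
qed

abbreviation diff_map :: "('v \<Rightarrow> 'a::ab_group_add) \<Rightarrow> 'v \<times> 'v \<Rightarrow> 'a" where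
  "diff_map f \<equiv> \<lambda>(u, v). f u - f v"

lemma card_reps_diff_minus:
  "card (reps (diff_map f) (V \<times> V) (- x)) = card (reps (diff_map f) (V \<times> V) x)"
  by (intro bij_betw_same_card[of prod.swap] bij_betwI[where g = prod.swap])
     (auto simp: reps_def algebra_simps)

text \<open>The count is the autocorrelation of the fibre sizes \<open>m\<close>, and 2 a b \<le>
  a^2 + b^2 with translation invariance makes it maximal at 0.\<close>

lemma card_reps_diff_le:
  fixes f :: "'v \<Rightarrow> 'a::ab_group_add"
  assumes fin: "finite V"
  shows "card (reps (diff_map f) (V \<times> V) x) \<le> card (reps (diff_map f) (V \<times> V) 0)"
proof -
  define m where "m g = real (card (reps f V g))" for g
  have eq: "real (card (reps (diff_map f) (V \<times> V) x)) = (\<Sum>g\<in>f ` V. m g * m (g - x))" for x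
  proof -
    have "a - b = x \<longleftrightarrow> b = a - x" for a b :: 'a by (auto simp: algebra_simps)
    then have "reps (diff_map f) (V \<times> V) x = (\<Union>g\<in>f ` V. reps f V g \<times> reps f V (g - x))"
      by (auto simp: reps_def)
    then have "card (reps (diff_map f) (V \<times> V) x) = card (\<Union>g\<in>f ` V. reps f V g \<times> reps f V (g - x))"
      by simp
    also have "\<dots> = (\<Sum>g\<in>f ` V. card (reps f V g \<times> reps f V (g - x)))"
      using fin by (intro card_UN_disjoint) (auto simp: reps_def)
    finally show ?thesis by (simp add: m_def card_cartesian_product)
  qed
  have m0: "m g = 0" if "g \<notin> f ` V" for g
  proof -
    have "reps f V g = {}" using that by (auto simp: reps_def)
    then show ?thesis by (simp add: m_def)
  qed
  \<comment> \<open>After the shift, summands outside the image of \<open>f\<close> vanish, so only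
    a part of the unshifted sum of squares is left.\<close>
  have "(\<Sum>g\<in>f ` V. (m (g - x))\<^sup>2) = (\<Sum>g\<in>(\<lambda>g. g - x) ` f ` V. (m g)\<^sup>2)"
    by (subst sum.reindex) (auto simp: inj_on_def)
  also have "\<dots> = (\<Sum>g\<in>(\<lambda>g. g - x) ` f ` V \<inter> f ` V. (m g)\<^sup>2)"
    using fin by (intro sum.mono_neutral_right) (auto simp: m0)
  also have "\<dots> \<le> (\<Sum>g\<in>f ` V. (m g)\<^sup>2)"
    using fin by (intro sum_mono2) auto
  finally have shift: "(\<Sum>g\<in>f ` V. (m (g - x))\<^sup>2) \<le> (\<Sum>g\<in>f ` V. (m g)\<^sup>2)" .
  have "2 * (\<Sum>g\<in>f ` V. m g * m (g - x)) \<le> (\<Sum>g\<in>f ` V. (m g)\<^sup>2) + (\<Sum>g\<in>f ` V. (m (g - x))\<^sup>2)"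
    unfolding sum_distrib_left sum.distrib[symmetric]
    by (intro sum_mono) (use sum_squares_bound in \<open>simp add: mult.assoc\<close>)
  then have "(\<Sum>g\<in>f ` V. m g * m (g - x)) \<le> (\<Sum>g\<in>f ` V. m g * m (g - 0))"
    using shift by (simp add: power2_eq_square)
  then show ?thesis unfolding eq[symmetric] by simp
qed

text \<open>\<open>L\<close> measures the loss; \<open>f\<close> resembles a uniform map onto a group of size \<open>Q\<close>.\<close>

lemma balog_szemeredi_gowers:
  fixes f :: "'v \<Rightarrow> 'a::ab_group_add" and L Q :: real
  assumes fin: "finite V" and ne: "V \<noteq> {}" and L: "L \<ge> 1" and Q: "Q > 0"
  defines "N \<equiv> real (card V)"
  defines "r \<equiv> \<lambda>x. real (card (reps (diff_map f) (V \<times> V) x))"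
  assumes diag: "r 0 \<le> L * N ^ 2 / Q"
    and energy: "N ^ 4 / (L * Q) \<le> (\<Sum>(u, v)\<in>V \<times> V. r (f u - f v))"
  obtains U where "U \<subseteq> V" "N \<le> 16 * L ^ 2 * card U"
    "real (card (diff_map f ` (U \<times> U))) \<le> 2 ^ 33 * L ^ 23 * Q"
    "Q \<le> 128 * L ^ 5 * card (f ` U)"
proof -
  have N: "N > 0" using fin ne by (simp add: N_def card_gt_0_iff)
  \<comment> \<open>\<open>M\<close> bounds every \<open>r x\<close>. The popularity threshold
    \<open>m\<close> is such that unpopular pairs carry at most half of the energy; \<open>T\<close>
    is such that, by Markov, at most N / (8 L^2) points lie in fibres larger than
    \<open>T\<close>.\<close>
  define M where "M = L * N ^ 2 / Q"
  have rM: "r x \<le> M" for x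
    using card_reps_diff_le[OF fin, of f x] diag unfolding r_def M_def by linarith
  have r0: "0 \<le> r x" for x by (simp add: r_def)
  define m where "m = N ^ 2 / (2 * L * Q)"
  define T where "T = 8 * L ^ 3 * N / Q"
  have pos: "M > 0" "m > 0" "T > 0" using N L Q by (auto simp: M_def m_def T_def)
  \<comment> \<open>Edges join points whose difference is popular. Inside \<open>G\<close>, where
    fibres are small, many points must give many distinct values of \<open>f\<close>.\<close>
  define G where "G = {v \<in> V. card (reps f V (f v)) \<le> T}"
  define E where "E u v \<longleftrightarrow> m \<le> r (f u - f v)" for u v
  define e where "e = {(u, v) \<in> V \<times> V. E u v}"
  have fe: "finite e" unfolding e_def by (rule finite_subset[of _ "V \<times> V", rotated]) (auto simp: fin)
  have "N ^ 4 / (L * Q) \<le> (\<Sum>p\<in>V \<times> V. r (diff_map f p))"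
    using energy by (simp add: case_prod_unfold)
  also have "\<dots> = (\<Sum>p\<in>e. r (diff_map f p)) + (\<Sum>p\<in>V \<times> V - e. r (diff_map f p))"
    using fin by (subst sum.subset_diff[of e]) (auto simp: e_def)
  also have "\<dots> \<le> (\<Sum>p\<in>e. M) + (\<Sum>p\<in>V \<times> V - e. m)"
    by (intro add_mono sum_mono) (auto simp: rM e_def E_def)
  also have "(\<Sum>p\<in>V \<times> V - e. m) \<le> (\<Sum>p\<in>V \<times> V. m)"
    using fin pos by (intro sum_mono2) auto
  finally have "N ^ 4 / (L * Q) \<le> card e * M + N ^ 2 * m"
    by (simp add: card_cartesian_product N_def power2_eq_square)
  moreover have "N ^ 4 / (L * Q) = M * (N ^ 2 / (2 * L ^ 2)) + N ^ 2 * m"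
    using L Q by (simp add: M_def m_def field_simps eval_nat_numeral)
  ultimately have "M * (N ^ 2 / (2 * L ^ 2)) \<le> M * card e" by (simp add: mult.commute)
  then have cE: "N ^ 2 / (2 * L ^ 2) \<le> card e"
    using pos by (simp only: mult_le_cancel_left_pos)
  have "(\<Sum>v\<in>V - G. T) \<le> (\<Sum>v\<in>V - G. real (card (reps f V (f v))))"
    by (intro sum_mono) (auto simp: G_def)
  also have "\<dots> \<le> (\<Sum>v\<in>V. real (card (reps f V (f v))))"
    using fin by (intro sum_mono2) auto
  also have "\<dots> = card {(u, v) \<in> V \<times> V. f v = f u}"
    using card_pairs[OF fin, of "\<lambda>u v. f v = f u"] by (simp add: reps_def)
  also have "\<dots> = r 0"
    unfolding r_def by (intro arg_cong[where f = "\<lambda>S. real (card S)"]) (auto simp: reps_def)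
  finally have "card (V - G) * T \<le> L * N ^ 2 / Q" using diag by simp
  then have cB: "real (card (V - G)) \<le> N / (8 * L ^ 2)"
    using N L Q by (simp add: T_def field_simps power2_eq_square power3_eq_cube)
  define e' where "e' = {(u, v) \<in> G \<times> G. E u v}"
  have G: "G \<subseteq> V" "finite G" using fin by (auto simp: G_def)
  have fe': "finite e'"
    unfolding e'_def by (rule finite_subset[of _ "G \<times> G", rotated]) (auto simp: G)
  \<comment> \<open>Discarding the points outside \<open>G\<close> loses at most 2 N N / (8 L^2) =
    N^2 / (4 L^2) pairs, half of the lower bound for \<open>e\<close>.\<close>
  have "e \<subseteq> e' \<union> ((V - G) \<times> V \<union> V \<times> (V - G))"
    by (auto simp: e_def e'_def)
  then have "card e \<le> card (e' \<union> ((V - G) \<times> V \<union> V \<times> (V - G)))"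
    using fin fe' by (intro card_mono) auto
  also have "\<dots> \<le> card e' + (card ((V - G) \<times> V) + card (V \<times> (V - G)))"
    by (intro order_trans[OF card_Un_le] add_mono card_Un_le order_refl)
  finally have "real (card e) \<le> card e' + 2 * (card (V - G) * N)"
    by (simp add: card_cartesian_product N_def mult_ac flip: of_nat_mult of_nat_add)
  moreover have "card (V - G) * N \<le> N / (8 * L ^ 2) * N" using cB N by (intro mult_right_mono) auto
  ultimately have ce': "1 / (4 * L ^ 2) * N ^ 2 \<le> card e'"
    using cE by (simp add: power2_eq_square)
  define \<rho> where "\<rho> = 1 / (4 * L ^ 2)"
  have rho: "\<rho> > 0" using L by (simp add: \<rho>_def)
  have cG: "real (card G) \<le> N" using G fin by (simp add: N_def card_mono)
  obtain U where U: "U \<subseteq> G" "\<rho> / 4 * N \<le> card U"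
    and path: "\<And>u v. u \<in> U \<Longrightarrow> v \<in> U \<Longrightarrow> \<exists>W\<subseteq>G. \<rho> / 4 * N \<le> card W \<and>
      (\<forall>w\<in>W. \<rho>^2 / 16 * N \<le> card {z \<in> G. E u z \<and> E w z} \<and> \<rho>^2 / 16 * N \<le> card {z \<in> G. E w z \<and> E v z})"
    using dependent_random_choice[OF G(2) cG N rho, of E] ce' unfolding \<rho>_def e'_def by blast
  have fibre: "real (card C) \<le> T * card ((\<lambda>z. a - f z) ` C)" if "C \<subseteq> G" for C a
  proof (rule card_le_fibre_times_image)
    show "finite C" using that G by (auto intro: finite_subset)
    fix x assume "x \<in> (\<lambda>z. a - f z) ` C"
    then obtain z where z: "z \<in> C" "x = a - f z" by auto
    then have "card (reps (\<lambda>z. a - f z) C x) \<le> card (reps f V (f z))"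
      using that G fin by (intro card_mono) (auto simp: reps_def)
    also have "real \<dots> \<le> T" using z that by (auto simp: G_def)
    finally show "real (card (reps (\<lambda>z. a - f z) C x)) \<le> T" by simp
  qed
  \<comment> \<open>A path u, z, w, z', v writes f u - f v as a sum of four popular differences,
    hence in terms of eight points of \<open>V\<close>.\<close>
  define h where "h = (\<lambda>(p, q). diff_map f p + diff_map f q)"
  define h' where "h' = (\<lambda>(p, q). h p + h q)"
  let ?V2 = "V \<times> V" and ?V4 = "(V \<times> V) \<times> V \<times> V"
  let ?V8 = "((V \<times> V) \<times> V \<times> V) \<times> (V \<times> V) \<times> V \<times> V"
  \<comment> \<open>A lower bound for the number of distinct values f u - f z, times
    \<open>m\<close> representations for each of the two differences.\<close>
  define m4 where "m4 = \<rho>^2 / 16 * N / T * (m * m)"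
  have m4: "m4 > 0" using rho N pos by (simp add: m4_def)
  have four: "m4 \<le> card (reps h ?V4 (f u - f w))"
    if "\<rho>^2 / 16 * N \<le> card {z \<in> G. E u z \<and> E w z}" for u w
  proof -
    define C where "C = {z \<in> G. E u z \<and> E w z}"
    define X where "X = (\<lambda>z. f u - f z) ` C"
    have "\<rho>^2 / 16 * N \<le> T * card X"
      using fibre[of C "f u"] that by (auto simp: C_def X_def)
    then have "\<rho>^2 / 16 * N / T \<le> card X" using pos by (simp add: field_simps)
    then have "m4 \<le> card X * (m * m)" unfolding m4_def using pos by (intro mult_right_mono) auto
    also have "\<dots> \<le> card (reps h ?V4 (f u - f w))"
      unfolding h_def
    proof (rule card_reps_add_ge)
      show "finite X" using G by (simp add: X_def C_def)
      fix x assume "x \<in> X"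
      then obtain z where z: "x = f u - f z" "E u z" "E w z" by (auto simp: X_def C_def)
      then show "m \<le> card (reps (diff_map f) ?V2 x)" by (simp add: E_def r_def)
      \<comment> \<open>The edge makes f w - f z popular; representation counts are even, so its
        negative is popular too.\<close>
      have "f u - f w - x = - (f w - f z)" using z by simp
      then show "m \<le> card (reps (diff_map f) ?V2 (f u - f w - x))"
        using z(3) by (simp only: card_reps_diff_minus E_def r_def)
    qed (use fin pos in auto)
    finally show ?thesis .
  qed
  \<comment> \<open>The same count one level up: distinct values f u - f w, times \<open>m4\<close>
    representations for each half of the path.\<close>
  define m8 where "m8 = \<rho> / 4 * N / T * (m4 * m4)"
  have eight: "m8 \<le> card (reps h' ?V8 (f u - f v))" if "u \<in> U" "v \<in> U" for u v
  proof -
    from path[OF that] obtain W where W: "W \<subseteq> G" "\<rho> / 4 * N \<le> card W"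
      and good: "\<And>w. w \<in> W \<Longrightarrow> \<rho>^2 / 16 * N \<le> card {z \<in> G. E u z \<and> E w z}"
        "\<And>w. w \<in> W \<Longrightarrow> \<rho>^2 / 16 * N \<le> card {z \<in> G. E w z \<and> E v z}"
      by blast
    define X where "X = (\<lambda>w. f u - f w) ` W"
    have "\<rho> / 4 * N / T \<le> card X"
      using fibre[OF W(1), of "f u"] W(2) pos by (simp add: field_simps X_def)
    then have "m8 \<le> card X * (m4 * m4)" unfolding m8_def using m4 by (intro mult_right_mono) auto
    also have "\<dots> \<le> card (reps h' ?V8 (f u - f v))"
      unfolding h'_def
    proof (rule card_reps_add_ge)
      show "finite X" using W G by (simp add: X_def finite_subset)
      fix x assume "x \<in> X"
      then obtain w where w: "x = f u - f w" "w \<in> W" by (auto simp: X_def)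
      show "m4 \<le> card (reps h ?V4 x)" using four[OF good(1)[OF w(2)]] w by simp
      show "m4 \<le> card (reps h ?V4 (f u - f v - x))" using four[OF good(2)[OF w(2)]] w by simp
    qed (use fin m4 in auto)
    finally show ?thesis .
  qed
  define D where "D = diff_map f ` (U \<times> U)"
  have fU: "finite U" using U G by (auto intro: finite_subset)
  then have "finite D" by (simp add: D_def)
  \<comment> \<open>Each difference claims at least \<open>m8\<close> of the N^8 octuples, and
    different differences claim disjoint sets of them.\<close>
  have "card D * m8 = (\<Sum>d\<in>D. m8)" by simp
  also have "\<dots> \<le> (\<Sum>d\<in>D. real (card (reps h' ?V8 d)))"
    using eight by (intro sum_mono) (auto simp: D_def)
  also have "\<dots> \<le> card ?V8"
    unfolding of_nat_sum[symmetric] using fin \<open>finite D\<close> by (intro of_nat_mono sum_card_reps) auto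
  also have "\<dots> = N ^ 8" by (simp add: N_def card_cartesian_product eval_nat_numeral)
  finally have "card D * m8 \<le> N ^ 8" .
  moreover have "m8 = N ^ 8 / (2 ^ 33 * L ^ 23 * Q)"
    unfolding m8_def m4_def T_def m_def \<rho>_def using N L Q
    by (simp add: field_simps) (simp add: eval_nat_numeral field_simps)
  ultimately have 1: "real (card D) \<le> 2 ^ 33 * L ^ 23 * Q"
    using N L Q by (simp add: field_simps)
  have 2: "N \<le> 16 * L ^ 2 * card U"
    using U(2) L by (simp add: \<rho>_def field_simps)
  \<comment> \<open>Small fibres keep the image of \<open>U\<close> large: it has at least |U| / T
    elements, and \<open>2\<close> bounds |U| below.\<close>
  have "real (card U) \<le> T * card (f ` U)"
  proof (rule card_le_fibre_times_image[OF fU])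
    fix x assume "x \<in> f ` U"
    then obtain z where z: "z \<in> U" "x = f z" by auto
    have "card (reps f U x) \<le> card (reps f V (f z))"
      using z U G fin by (intro card_mono) (auto simp: reps_def)
    also have "real \<dots> \<le> T" using z U by (auto simp: G_def)
    finally show "real (card (reps f U x)) \<le> T" by simp
  qed
  then have "16 * L^2 * card U \<le> 16 * L^2 * (T * card (f ` U))" using L by (intro mult_left_mono) auto
  with 2 have "N \<le> 16 * L^2 * (T * card (f ` U))" by linarith
  then have "N * Q \<le> N * (128 * L ^ 5 * card (f ` U))"
    using N L Q by (simp add: T_def field_simps eval_nat_numeral)
  then have 3: "Q \<le> 128 * L ^ 5 * card (f ` U)" using N by simp
  show thesis using that[of U] U G 1 2 3 by (auto simp: D_def)
qed

section \<open>Tuples on the moment curve\<close>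

definition moment_point :: "nat \<Rightarrow> int \<Rightarrow> nat \<Rightarrow> real" where
  "moment_point k a j = (if j \<in> {1..k} then real_of_int a ^ j else 0)"

definition tuple_sum :: "nat \<Rightarrow> nat \<Rightarrow> (nat \<Rightarrow> int) \<Rightarrow> nat \<Rightarrow> real" where
  "tuple_sum k m x = (\<Sum>i=1..m. moment_point k (x i))"

abbreviation tuples :: "nat \<Rightarrow> int set \<Rightarrow> (nat \<Rightarrow> int) set" where
  "tuples m A \<equiv> {1..m} \<rightarrow>\<^sub>E A"

lemma moment_curve_eq: "moment_curve k A = moment_point k ` A"
  by (auto simp: moment_curve_def moment_point_def fun_eq_iff image_iff)

lemma sum_fun_apply: "(\<Sum>i\<in>I. F i) j = (\<Sum>i\<in>I. F i j)"
  by (induction I rule: infinite_finite_induct) auto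

lemma finite_tuples: "finite A \<Longrightarrow> finite ({i..m::nat} \<rightarrow>\<^sub>E A)"
  by (intro finite_PiE) auto

lemma card_tuples: "card ({i..m::nat} \<rightarrow>\<^sub>E A) = card A ^ (Suc m - i)"
  by (simp add: card_PiE)

lemma tuple_sum_eq_iff:
  "tuple_sum k m x = tuple_sum k m y \<longleftrightarrow> (\<forall>j\<in>{1..k}. (\<Sum>i=1..m. x i ^ j) = (\<Sum>i=1..m. y i ^ j))"
proof -
  have "tuple_sum k m x j = (if j \<in> {1..k} then real_of_int (\<Sum>i=1..m. x i ^ j) else 0)" for x j
    by (auto simp: tuple_sum_def sum_fun_apply moment_point_def)
  then show ?thesis by (auto simp: fun_eq_iff simp del: of_int_sum of_int_power)
qed

section \<open>Solution counts through sums of tuples\<close>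

lemma J_eq_card_reps: "J m k A = card (reps (diff_map (tuple_sum k m)) (tuples m A \<times> tuples m A) 0)"
  unfolding J_def reps_def by (intro arg_cong[where f = card]) (auto simp: tuple_sum_eq_iff)

text \<open>Cutting a tuple after its first \<open>a\<close> entries is injective, and the sums of
  the two pieces add up to the sum of the tuple.\<close>

lemma J_add_le:
  assumes "finite A"
  shows "J (a + b) k A \<le> card {((u, p), (v, q)) \<in> (tuples a A \<times> tuples b A) \<times> (tuples a A \<times> tuples b A).
           tuple_sum k a u + tuple_sum k b p = tuple_sum k a v + tuple_sum k b q}"
    (is "_ \<le> card ?R")
proof -
  define sp where "sp = (\<lambda>x :: nat \<Rightarrow> int. (restrict x {1..a}, restrict (\<lambda>i. x (i + a)) {1..b}))"
  have range: "sp x \<in> tuples a A \<times> tuples b A" if "x \<in> tuples (a + b) A" for x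
    using that by (auto simp: sp_def PiE_iff)
  have sum: "tuple_sum k a (fst (sp x)) + tuple_sum k b (snd (sp x)) = tuple_sum k (a + b) x" for x
  proof -
    have "(\<Sum>i=1..a + b. moment_point k (x i)) = 
        (\<Sum>i=1..a. moment_point k (x i)) + (\<Sum>i=1..b. moment_point k (x (i + a)))"
      by (induction b) (simp_all add: add.commute add.left_commute)
    then show ?thesis by (simp add: sp_def tuple_sum_def)
  qed
  have inj: "x = y" if "x \<in> tuples (a + b) A" "y \<in> tuples (a + b) A" "sp x = sp y" for x y
  proof (rule PiE_ext[OF that(1,2)])
    fix i assume i: "i \<in> {1..a + b}"
    have 1: "restrict x {1..a} i = restrict y {1..a} i" using that(3) by (simp add: sp_def)
    \<comment> \<open>An entry i beyond \<open>a\<close> sits at position i - a of the second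
      piece.\<close>
    have "restrict (\<lambda>i. x (i + a)) {1..b} (i - a) = restrict (\<lambda>i. y (i + a)) {1..b} (i - a)"
      using that(3) by (simp add: sp_def)
    with 1 i show "x i = y i" by (cases "i \<le> a") (auto simp: restrict_def split: if_splits)
  qed
  have fin: "finite ?R"
    by (rule finite_subset[of _ "(tuples a A \<times> tuples b A) \<times> (tuples a A \<times> tuples b A)", rotated])
       (use assms in \<open>auto simp: finite_tuples\<close>)
  show ?thesis
    unfolding J_def
  proof (rule card_inj_on_le[OF _ _ fin])
    let ?S = "{(x, y) \<in> tuples (a + b) A \<times> tuples (a + b) A.
        \<forall>j\<in>{1..k}. (\<Sum>i=1..a + b. x i ^ j) = (\<Sum>i=1..a + b. y i ^ j)}"
    show "inj_on (map_prod sp sp) ?S"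
      by (rule inj_onI) (auto dest: inj[simplified])
    show "map_prod sp sp ` ?S \<subseteq> ?R"
    proof (rule image_subsetI)
      fix z assume "z \<in> ?S"
      then obtain x y where z: "z = (x, y)" and xy: "x \<in> tuples (a + b) A" "y \<in> tuples (a + b) A"
        "\<forall>j\<in>{1..k}. (\<Sum>i=1..a + b. x i ^ j) = (\<Sum>i=1..a + b. y i ^ j)"
        by blast
      then have "tuple_sum k (a + b) x = tuple_sum k (a + b) y" by (simp only: tuple_sum_eq_iff)
      then show "map_prod sp sp z \<in> ?R"
        unfolding z using range[OF xy(1)] range[OF xy(2)] sum[of x] sum[of y] by (auto simp: mem_Times_iff case_prod_unfold)
    qed
  qed
qed

text \<open>Fixing \<open>b\<close> variables on each side prescribes the difference of the
  remaining sums, and by \<open>card_reps_diff_le\<close> the prescription 0 has the most solutions.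
  This carries the lower bound from \<open>s\<close> down to k (k + 1) variables.\<close>

lemma J_add_le_mult:
  assumes "finite A"
  shows "J (a + b) k A \<le> card A ^ (2 * b) * J a k A"
proof -
  let ?a = "tuples a A" and ?b = "tuples b A"
  let ?f = "tuple_sum k a" and ?g = "tuple_sum k b"
  let ?r = "\<lambda>x. reps (diff_map ?f) (?a \<times> ?a) x"
  have fin: "finite ?a" "finite ?b" using assms by (auto simp: finite_tuples)
  have "J (a + b) k A \<le> card {((u, p), (v, q)) \<in> (?a \<times> ?b) \<times> (?a \<times> ?b). ?f u + ?g p = ?f v + ?g q}"
    by (rule J_add_le[OF assms])
  also have "\<dots> = card (SIGMA (p, q):?b \<times> ?b. ?r (?g q - ?g p))"
    by (rule bij_betw_same_card[of "\<lambda>((u, p), (v, q)). ((p, q), (u, v))"],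
        rule bij_betwI[where g = "\<lambda>((p, q), (u, v)). ((u, p), (v, q))"])
       (auto simp: reps_def algebra_simps)
  also have "\<dots> = (\<Sum>(p, q)\<in>?b \<times> ?b. card (?r (?g q - ?g p)))"
    using fin by (simp add: case_prod_unfold)
  also have "\<dots> \<le> (\<Sum>(p, q)\<in>?b \<times> ?b. J a k A)"
    using card_reps_diff_le[OF fin(1)] by (intro sum_mono) (auto simp: J_eq_card_reps)
  also have "\<dots> = card A ^ (2 * b) * J a k A"
    using fin by (simp add: card_cartesian_product card_tuples power_add mult_2 case_prod_unfold)
  finally show ?thesis .
qed

text \<open>Rewriting f u + f p = f v + f q as f u - f v = f q - f p exhibits the additive energy
  that \<open>balog_szemeredi_gowers\<close> asks for.\<close>

lemma J_double_le_energy: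
  assumes "finite A"
  shows "J (m + m) k A \<le> (\<Sum>(u, v)\<in>tuples m A \<times> tuples m A.
           card (reps (diff_map (tuple_sum k m)) (tuples m A \<times> tuples m A) (tuple_sum k m u - tuple_sum k m v)))"
proof -
  let ?a = "tuples m A"
  let ?f = "tuple_sum k m"
  let ?r = "\<lambda>x. reps (diff_map ?f) (?a \<times> ?a) x"
  have fin: "finite ?a" using assms by (auto simp: finite_tuples)
  have "J (m + m) k A \<le> card {((u, p), (v, q)) \<in> (?a \<times> ?a) \<times> (?a \<times> ?a). ?f u + ?f p = ?f v + ?f q}"
    by (rule J_add_le[OF assms])
  also have "\<dots> = card (SIGMA (u, v):?a \<times> ?a. ?r (?f u - ?f v))"
    by (rule bij_betw_same_card[of "\<lambda>((u, p), (v, q)). ((u, v), (q, p))"],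
        rule bij_betwI[where g = "\<lambda>((u, v), (q, p)). ((u, p), (v, q))"])
       (auto simp: reps_def algebra_simps)
  also have "\<dots> = (\<Sum>(u, v)\<in>?a \<times> ?a. card (?r (?f u - ?f v)))"
    using fin by (simp add: case_prod_unfold)
  finally show ?thesis .
qed

text \<open>Pigeonhole on the last m - 1 entries. In the most popular fibre the first entry
  determines the tuple, and the fixed entries contribute the constant translation
  \<open>t\<close>.\<close>

lemma large_fibre:
  assumes fin: "finite A" and U: "U \<subseteq> tuples m A" "U \<noteq> {}" and m: "m \<ge> 1"
  obtains A' t where "A' \<subseteq> A" "card U \<le> card A' * card A ^ (m - 1)"
    "\<And>a. a \<in> A' \<Longrightarrow> moment_point k a + t \<in> tuple_sum k m ` U"
proof -
  define \<pi> where "\<pi> = (\<lambda>x :: nat \<Rightarrow> int. restrict x {2..m})"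
  have fU: "finite U" using U fin by (auto intro: finite_subset simp: finite_tuples)
  define T where "T = Max ((\<lambda>y. card (reps \<pi> U y)) ` \<pi> ` U)"
  have "T \<in> (\<lambda>y. card (reps \<pi> U y)) ` \<pi> ` U"
    unfolding T_def using fU U by (intro Max_in) auto
  then obtain y where y: "T = card (reps \<pi> U y)" by auto
  define F where "F = reps \<pi> U y"
  have "real (card U) \<le> real T * card (\<pi> ` U)"
    using fU by (intro card_le_fibre_times_image) (auto simp: T_def)
  also have "\<dots> \<le> real T * card ({2..m} \<rightarrow>\<^sub>E A)"
    using U fin m by (intro mult_left_mono of_nat_mono card_mono finite_PiE) (auto simp: \<pi>_def PiE_iff)
  also have "card ({2..m} \<rightarrow>\<^sub>E A) = card A ^ (m - 1)" by (simp add: card_tuples)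
  finally have 1: "card U \<le> T * card A ^ (m - 1)" by (simp only: of_nat_le_iff flip: of_nat_mult)
  have "inj_on (\<lambda>x. x 1) F"
  proof (rule inj_onI)
    fix x x' assume x: "x \<in> F" "x' \<in> F" "x 1 = x' 1"
    then have xA: "x \<in> tuples m A" "x' \<in> tuples m A" using U by (auto simp: F_def reps_def)
    show "x = x'"
    proof (rule PiE_ext[OF xA])
      fix i assume i: "i \<in> {1..m}"
      have "restrict x {2..m} i = restrict x' {2..m} i" using x by (simp add: F_def reps_def \<pi>_def)
      with i x(3) show "x i = x' i" by (cases "i = 1") (auto simp: restrict_def split: if_splits)
    qed
  qed
  then have 2: "card ((\<lambda>x. x 1) ` F) = T" by (simp add: card_image y F_def)
  have 3: "(\<lambda>x. x 1) ` F \<subseteq> A" using U m by (auto simp: F_def reps_def PiE_iff)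
  have "moment_point k (x 1) + (\<Sum>i=2..m. moment_point k (y i)) = tuple_sum k m x" if "x \<in> F" for x
  proof -
    have "y = restrict x {2..m}" using that by (auto simp: F_def reps_def \<pi>_def)
    moreover have "{1..m} = insert 1 {2..m}" using m by auto
    ultimately show ?thesis by (simp add: tuple_sum_def)
  qed
  then have "\<And>a. a \<in> (\<lambda>x. x 1) ` F \<Longrightarrow>
      moment_point k a + (\<Sum>i=2..m. moment_point k (y i)) \<in> tuple_sum k m ` U"
    by (auto simp: F_def reps_def)
  then show thesis using that 1 2 3 by blast
qed

text \<open>With \<open>H\<close> the sums of the tuples in \<open>U\<close>, the curve over
  \<open>A'\<close> lies in a translate of \<open>H\<close>, so \<open>H\<close> minus the curve is
  no larger than \<open>H\<close> minus \<open>H\<close>. The lower bound for |H| turns this into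
  the ratio \<open>2 ^ 40 * L ^ 28\<close> for \<open>plunnecke\<close>; the upper bound for |H|
  supplies the last factor.\<close>

lemma small_iterated_sumsets:
  fixes L Q :: real
  assumes fin: "finite A" "A \<noteq> {}" and m: "m \<ge> 1" and L: "L \<ge> 1" and Q: "Q > 0"
    and upper: "real (J m k A) \<le> L * real (card A) ^ (2 * m) / Q"
    and lower: "real (card A) ^ (4 * m) / (L * Q) \<le> J (m + m) k A"
  obtains A' where "A' \<subseteq> A" "real (card A) \<le> 16 * L ^ 2 * card A'"
    "\<And>l. real (card (iterated_sumset l (moment_curve k A'))) \<le> (2 ^ 40 * L ^ 28) ^ l * (2 ^ 33 * L ^ 23 * Q)"
proof -
  let ?V = "tuples m A" and ?f = "tuple_sum k m"
  have fV: "finite ?V" "?V \<noteq> {}" using fin by (auto simp: finite_tuples PiE_eq_empty_iff)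
  have n: "real (card A) > 0" using fin by (simp add: card_gt_0_iff)
  have "real (card (reps (diff_map ?f) (?V \<times> ?V) 0)) \<le> L * real (card ?V) ^ 2 / Q"
    using upper by (simp add: J_eq_card_reps card_tuples flip: power_mult) (simp add: mult.commute)
  moreover have "real (card ?V) ^ 4 / (L * Q) \<le>
      (\<Sum>(u, v)\<in>?V \<times> ?V. real (card (reps (diff_map ?f) (?V \<times> ?V) (?f u - ?f v))))"
  proof -
    have "real (card ?V) ^ 4 / (L * Q) \<le> J (m + m) k A"
      using lower by (simp add: card_tuples mult.commute flip: power_mult)
    also have "\<dots> \<le> real (\<Sum>(u, v)\<in>?V \<times> ?V. card (reps (diff_map ?f) (?V \<times> ?V) (?f u - ?f v)))"
      by (intro of_nat_mono J_double_le_energy fin)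
    finally show ?thesis by (simp add: case_prod_unfold)
  qed
  ultimately obtain U where U: "U \<subseteq> ?V" "real (card ?V) \<le> 16 * L ^ 2 * card U"
      and D: "real (card (diff_map ?f ` (U \<times> U))) \<le> 2 ^ 33 * L ^ 23 * Q"
      and H: "Q \<le> 128 * L ^ 5 * card (?f ` U)"
    using balog_szemeredi_gowers[OF fV L Q, of ?f] by blast
  have Une: "U \<noteq> {}" using H Q by auto
  have fU: "finite U" using U fV by (auto intro: finite_subset)
  obtain A' t where A': "A' \<subseteq> A" "card U \<le> card A' * card A ^ (m - 1)"
      and t: "\<And>a. a \<in> A' \<Longrightarrow> moment_point k a + t \<in> ?f ` U"
    using large_fibre[OF fin(1) U(1) Une m, of k] by blast
  have fA': "finite A'" using A' fin by (auto intro: finite_subset)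
  have "real (card A) ^ (m - 1) * card A = card ?V"
    using m by (simp add: card_tuples flip: power_Suc2)
  also have "\<dots> \<le> 16 * L ^ 2 * card U" by (rule U(2))
  also have "\<dots> \<le> 16 * L ^ 2 * real (card A' * card A ^ (m - 1))"
    using A'(2) L by (intro mult_left_mono of_nat_mono) auto
  also have "\<dots> = real (card A) ^ (m - 1) * (16 * L ^ 2 * card A')" by simp
  finally have 1: "real (card A) \<le> 16 * L ^ 2 * card A'" using n by (simp only: mult_le_cancel_left) auto
  define H where "H = ?f ` U"
  define B where "B = uminus ` moment_curve k A'"
  have fB: "finite B" using fA' by (simp add: B_def moment_curve_eq)
  have fH: "finite H" "H \<noteq> {}" using fU Une by (auto simp: H_def)
  have "H + B \<subseteq> (\<lambda>z. z + t) ` diff_map ?f ` (U \<times> U)"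
  proof
    fix z assume "z \<in> H + B"
    then obtain u a where z: "u \<in> U" "a \<in> A'" "z = ?f u - moment_point k a"
      by (auto simp: H_def B_def moment_curve_eq set_plus_def)
    from t[OF z(2)] obtain v where "v \<in> U" "moment_point k a + t = ?f v" by auto
    then have "z = (?f u - ?f v) + t" using z by (simp add: algebra_simps flip: \<open>moment_point k a + t = ?f v\<close>)
    then show "z \<in> (\<lambda>z. z + t) ` diff_map ?f ` (U \<times> U)" using z(1) \<open>v \<in> U\<close> by force
  qed
  then have "card (H + B) \<le> card ((\<lambda>z. z + t) ` diff_map ?f ` (U \<times> U))"
    using fU by (intro card_mono) auto
  also have "\<dots> \<le> card (diff_map ?f ` (U \<times> U))" using fU by (intro card_image_le) auto
  finally have HB: "real (card (H + B)) \<le> 2 ^ 33 * L ^ 23 * Q" using D by linarith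
  also have "\<dots> \<le> 2 ^ 33 * L ^ 23 * (128 * L ^ 5 * card H)"
    using H L unfolding H_def by (intro mult_left_mono) auto
  also have "\<dots> = 2 ^ 40 * L ^ 28 * card H"
    using power_add[of L 23 5] by simp
  finally have K: "real (card (H + B)) \<le> 2 ^ 40 * L ^ 28 * card H" .
  \<comment> \<open>Subtracting one fixed sum embeds \<open>H\<close> into its difference
    set.\<close>
  obtain u0 where u0: "u0 \<in> U" using Une by blast
  have "card H = card ((\<lambda>h. h - ?f u0) ` H)"
    by (rule card_image[symmetric]) (auto simp: inj_on_def)
  also have "\<dots> \<le> card (diff_map ?f ` (U \<times> U))"
    using fU u0 by (intro card_mono) (auto simp: H_def)
  finally have Hle: "real (card H) \<le> 2 ^ 33 * L ^ 23 * Q" using D by linarith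
  have "real (card (iterated_sumset l (moment_curve k A'))) \<le> (2 ^ 40 * L ^ 28) ^ l * (2 ^ 33 * L ^ 23 * Q)" for l
  proof -
    have "card (iterated_sumset l (moment_curve k A')) = card (iterated_sumset l B)"
      by (simp add: B_def iterated_sumset_uminus card_image)
    also have "real \<dots> \<le> (2 ^ 40 * L ^ 28) ^ l * card H"
      by (rule plunnecke[OF fH(1) fB fH(2) K])
    also have "\<dots> \<le> (2 ^ 40 * L ^ 28) ^ l * (2 ^ 33 * L ^ 23 * Q)"
      using Hle L by (intro mult_left_mono) auto
    finally show ?thesis .
  qed
  then show thesis using that A'(1) 1 by blast
qed

section \<open>The critical exponent\<close>

lemma card_power_le_J:
  assumes "finite A"
  shows "card A ^ m \<le> J m k A"
proof -
  have "card A ^ m = card ((\<lambda>x. (x, x)) ` tuples m A)"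
    by (subst card_image) (auto simp: inj_on_def card_tuples)
  also have "\<dots> \<le> card (reps (diff_map (tuple_sum k m)) (tuples m A \<times> tuples m A) 0)"
    using assms by (intro card_mono) (auto simp: finite_tuples reps_def)
  finally show ?thesis by (simp only: J_eq_card_reps)
qed

text \<open>Constant tuples at two distinct elements violate the equation for j = 1. This refutes
  the case of non-positive \<open>D\<close> in the theorem.\<close>

lemma J_less:
  assumes "finite A" "2 \<le> card A" "1 \<le> s" "1 \<le> k"
  shows "J s k A < card A ^ (2 * s)"
proof -
  let ?V = "tuples s A"
  let ?S = "{(x, y) \<in> ?V \<times> ?V. \<forall>j\<in>{1..k}. (\<Sum>i=1..s. x i ^ j) = (\<Sum>i=1..s. y i ^ j)}"
  obtain a b where ab: "a \<in> A" "b \<in> A" "a \<noteq> b"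
    using card_le_Suc0_iff_eq[OF assms(1)] assms(2) by (metis not_less_eq_eq numeral_2_eq_2)
  let ?x = "\<lambda>c. \<lambda>i\<in>{1..s}. c :: int"
  have "(?x a, ?x b) \<in> ?V \<times> ?V" using ab by auto
  moreover have "(?x a, ?x b) \<notin> ?S"
    using ab assms(3,4) by (auto intro!: bexI[of _ 1])
  ultimately have "?S \<subset> ?V \<times> ?V" by blast
  then have "card ?S < card (?V \<times> ?V)"
    using assms(1) by (intro psubset_card_mono) (auto simp: finite_tuples)
  then show ?thesis
    by (simp add: J_def card_cartesian_product card_tuples mult_2 power_add)
qed

text \<open>Take s = k = 1: the diagonal already gives |A| solutions, while admissibility allows
  |A|^(1 + t).\<close>

lemma admissible_exponents_nonneg:
  assumes "t \<in> admissible_exponents"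
  shows "0 \<le> t"
proof -
  have "1 \<le> (1::nat) \<and> 1 \<le> (1::nat) \<and> real 1 \<ge> real 1 * (real 1 + 1) / 2" by simp
  with assms obtain N where N: "\<And>A :: int set. finite A \<and> A \<noteq> {} \<and> N \<le> card A \<Longrightarrow>
      real (J 1 1 A) \<le> real (card A) powr (2 * real 1 - real 1 * (real 1 + 1) / 2) * real (card A) powr t"
    unfolding admissible_exponents_def by blast
  \<comment> \<open>At least two elements are taken so that powers of |A| compare as their exponents
    do.\<close>
  define A where "A = int ` {1..max N 2}"
  have A: "finite A" "A \<noteq> {}" "card A = max N 2"
    by (auto simp: A_def card_image)
  have "real (card A) powr 1 = card A ^ 1" using A by simp
  also have "\<dots> \<le> J 1 1 A" by (intro of_nat_mono card_power_le_J A)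
  also have "\<dots> \<le> real (card A) powr (1 + t)"
    using N[of A] A by (simp add: powr_add)
  finally show ?thesis using A by (subst (asm) powr_le_cancel_iff) auto
qed

text \<open>Excludes the value minus infinity and later yields D \<le> k (k + 1) / 2 \<le>
  k^2.\<close>

lemma Lambda_nonneg: "0 \<le> Lambda"
  unfolding Lambda_def by (intro Inf_greatest) (auto dest: admissible_exponents_nonneg)

lemma J_upper_bound:
  assumes lam: "Lambda = ereal lam" and "\<eta> > 0" and "1 \<le> s" "1 \<le> k" "real s \<ge> real k * (real k + 1) / 2"
  obtains N where "\<And>A :: int set. finite A \<Longrightarrow> A \<noteq> {} \<Longrightarrow> N \<le> card A \<Longrightarrow>
    real (J s k A) \<le> real (card A) powr (2 * real s - real k * (real k + 1) / 2 + lam + \<eta>)"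
proof -
  have "Inf (ereal ` admissible_exponents) < ereal (lam + \<eta>)"
    using lam \<open>\<eta> > 0\<close> by (simp add: Lambda_def)
  then obtain t where t: "t \<in> admissible_exponents" "t < lam + \<eta>"
    by (auto simp: Inf_less_iff)
  from t(1) assms obtain N where N: "\<And>A :: int set. finite A \<and> A \<noteq> {} \<and> N \<le> card A \<Longrightarrow>
      real (J s k A) \<le> real (card A) powr (2 * real s - real k * (real k + 1) / 2) * real (card A) powr t"
    unfolding admissible_exponents_def by blast
  show thesis
  proof (rule that)
    fix A :: "int set" assume A: "finite A" "A \<noteq> {}" "N \<le> card A"
    then have "1 \<le> real (card A)" by (simp add: card_gt_0_iff Suc_le_eq)
    then have "real (card A) powr (2 * real s - real k * (real k + 1) / 2) * real (card A) powr t
        \<le> real (card A) powr (2 * real s - real k * (real k + 1) / 2 + lam + \<eta>)"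
      using t(2) unfolding powr_add[symmetric] by (intro powr_mono) auto
    with N[of A] A show "real (J s k A) \<le> real (card A) powr (2 * real s - real k * (real k + 1) / 2 + lam + \<eta>)"
      by auto
  qed
qed

text \<open>The left side is the exponent of |A| in the sumset bound, the right side the one allowed
  when |A'| \<ge> |A|^(1 - 3 \<delta>); \<open>kk\<close> stands for k^2. All losses are small
  multiples of \<open>E\<close>: \<delta> and \<delta> E are at most E / 21600, and 29 l + 24 \<le>
  53 (l + kk).\<close>

lemma exponent_le:
  fixes D \<epsilon> kk l :: real
  assumes D: "0 < D" "D \<le> kk" and eps: "0 < \<epsilon>" "\<epsilon> * kk \<le> 1" and l: "1 \<le> l"
  defines "\<delta> \<equiv> \<epsilon> * D / 21600"
  shows "29 * \<delta> * l + (24 * \<delta> + D) \<le> (1 - 3 * \<delta>) * (D * (1 + \<epsilon> * (l + kk)))"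
proof -
  define E where "E = \<epsilon> * (l + kk)"
  have "\<epsilon> * D \<le> \<epsilon> * kk" using D eps by simp
  moreover have "0 \<le> \<epsilon> * l" using eps l by simp
  ultimately have "\<epsilon> * D \<le> E" "\<epsilon> * D \<le> 1"
    using eps(2) unfolding E_def distrib_left by linarith+
  then have "\<delta> \<le> E / 21600" "\<delta> \<le> 1 / 21600" by (simp_all add: \<delta>_def)
  have E: "E > 0" using D eps l by (simp add: E_def)
  have "\<delta> * E \<le> 1 / 21600 * E" using \<open>\<delta> \<le> 1 / 21600\<close> E by (intro mult_right_mono) auto
  moreover have "\<epsilon> * (29 * l + 24) \<le> \<epsilon> * (53 * (l + kk))" using eps l D by (intro mult_left_mono) auto
  then have "\<epsilon> * (29 * l + 24) / 21600 \<le> 53 * E / 21600" by (simp add: E_def algebra_simps)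
  ultimately have "0 \<le> E - 3 * \<delta> - 3 * (\<delta> * E) - \<epsilon> * (29 * l + 24) / 21600"
    using \<open>\<delta> \<le> E / 21600\<close> E by linarith
  then have "0 \<le> D * (E - 3 * \<delta> - 3 * (\<delta> * E) - \<epsilon> * (29 * l + 24) / 21600)"
    using D by simp
  also have "\<dots> = (1 - 3 * \<delta>) * (D * (1 + E)) - (29 * \<delta> * l + (24 * \<delta> + D))"
    by (simp add: \<delta>_def field_simps)
  finally show ?thesis by (simp add: E_def)
qed

text \<open>The non-degenerate case, where the loss becomes \<open>L\<close> = |A|^\<delta> and the
  model group size \<open>Q\<close> = |A|^D.\<close>

lemma theorem6p1_finite_Lambda:
  fixes s k :: nat and lam \<epsilon> :: real
  assumes s: "1 \<le> s" "1 \<le> k" "s \<ge> k * (k + 1)"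
    and lam: "Lambda = ereal lam"
    and eps: "0 < \<epsilon>" "\<epsilon> * real k ^ 2 \<le> 1"
  defines "D \<equiv> real k * (real k + 1) / 2 - lam"
  assumes D: "0 < D"
  shows "\<exists>N :: nat. \<forall>A :: int set. finite A \<and> A \<noteq> {} \<and> N \<le> card A \<longrightarrow>
      (\<forall>\<alpha> :: real. 0 < \<alpha> \<and> \<alpha> \<le> 1 \<and> ln (inverse \<alpha>) \<le> \<epsilon> * D / 21600 * ln (real (card A)) \<and>
         real (J s k A) = \<alpha> * real (card A) powr (2 * real s - D) \<longrightarrow>
      (\<exists>A' \<subseteq> A. real (card A') \<ge> \<alpha> powr (\<epsilon> / 4) * real (card A) powr (1 - \<epsilon> * real k ^ 2) \<and>
        (\<forall>l :: nat. 1 \<le> l \<longrightarrow> real (card (iterated_sumset l (moment_curve k A'))) \<le>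
           \<alpha> powr (- (1 + 2 * \<epsilon> * (real l + real k ^ 2))) *
           real (card A') powr (D * (1 + \<epsilon> * (real l + real k ^ 2))))))"
proof -
  define \<delta> where "\<delta> = \<epsilon> * D / 21600"
  have delta: "\<delta> > 0" using eps D by (simp add: \<delta>_def)
  define K where "K = k * (k + 1) div 2"
  have K2: "K + K = k * (k + 1)" by (simp add: K_def flip: mult_2)
  have "real (K + K) = real k * (real k + 1)" unfolding K2 by (simp add: algebra_simps)
  then have K: "real K = real k * (real k + 1) / 2" by simp
  have K1: "1 \<le> K"
    using K2 s(2) by (cases K) auto
  have lam0: "0 \<le> lam" using Lambda_nonneg unfolding lam by simp
  have k1: "1 \<le> real k" using s by simp
  have "real k * 1 \<le> real k * real k" using k1 by (intro mult_left_mono) auto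
  then have Dk: "D \<le> real k ^ 2" using lam0 by (simp add: D_def power2_eq_square field_simps)
  obtain N where N: "\<And>A :: int set. finite A \<Longrightarrow> A \<noteq> {} \<Longrightarrow> N \<le> card A \<Longrightarrow>
    real (J K k A) \<le> real (card A) powr (2 * real K - real k * (real k + 1) / 2 + lam + \<delta>)"
    using J_upper_bound[OF lam delta K1 s(2)] K by auto
  \<comment> \<open>Ensures |A|^\<delta> \<ge> 2^40, so that one factor \<open>L\<close> absorbs any
    of the constants 16, 2^33 and 2^40.\<close>
  define N' where "N' = nat \<lceil>(2 ^ 40) powr (1 / \<delta>)\<rceil>"
  show ?thesis
  proof (intro exI[of _ "max N N'"] allI impI, elim conjE)
    fix A :: "int set" and \<alpha> :: real
    assume A: "finite A" "A \<noteq> {}" "max N N' \<le> card A" and alpha: "0 < \<alpha>" "\<alpha> \<le> 1"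
      and ln: "ln (inverse \<alpha>) \<le> \<epsilon> * D / 21600 * ln (real (card A))"
      and JA: "real (J s k A) = \<alpha> * real (card A) powr (2 * real s - D)"
    define n where "n = real (card A)"
    have n1: "n \<ge> 1" using A by (simp add: n_def card_gt_0_iff Suc_le_eq)
    have pw: "n ^ m = n powr real m" for m using n1 by (simp add: powr_realpow)
    define L where "L = n powr \<delta>"
    define Q where "Q = n powr D"
    have "(2 ^ 40) powr (1 / \<delta>) \<le> real N'" unfolding N'_def by (rule real_nat_ceiling_ge)
    also have "\<dots> \<le> n" using A by (simp add: n_def)
    finally have "((2 ^ 40) powr (1 / \<delta>)) powr \<delta> \<le> n powr \<delta>"
      using delta by (intro powr_mono2) auto
    then have big: "2 ^ 40 \<le> L" using delta by (simp add: powr_powr L_def)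
    have L1: "L \<ge> 1" and Q0: "Q > 0" using big n1 by (auto simp: Q_def)
    have "real (J K k A) \<le> n powr (\<delta> + real (2 * K) - D)"
      using N[of A] A by (simp add: n_def D_def algebra_simps)
    then have upper: "real (J K k A) \<le> L * real (card A) ^ (2 * K) / Q"
      unfolding n_def[symmetric] pw L_def Q_def by (simp add: powr_add powr_diff)
    have lnn: "ln (inverse \<alpha>) \<le> \<delta> * ln n" using ln by (simp add: \<delta>_def n_def)
    have "n powr (- \<delta>) = exp (- (\<delta> * ln n))" using n1 by (simp add: powr_def)
    also have "\<dots> \<le> exp (ln \<alpha>)" using lnn alpha by (subst exp_le_cancel_iff) (simp add: ln_inverse)
    finally have alpha_ge: "n powr (- \<delta>) \<le> \<alpha>" using alpha by simp
    \<comment> \<open>The \<open>b\<close> surplus variables on each side cost a factor n^(2 b),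
      which cancels since 2 s = 4 K + 2 b.\<close>
    define b where "b = s - (K + K)"
    have sb: "s = (K + K) + b" using s K2 by (simp add: b_def)
    have "n powr real (2 * b) * n powr (real (4 * K) - D - \<delta>) = n powr (- \<delta>) * n powr (2 * real s - D)"
      unfolding powr_add[symmetric] sb by (simp add: algebra_simps)
    also have "\<dots> \<le> real (J s k A)"
      unfolding JA n_def[symmetric] using alpha_ge by (intro mult_right_mono) auto
    also have "\<dots> \<le> real (card A ^ (2 * b) * J (K + K) k A)"
      unfolding sb by (intro of_nat_mono J_add_le_mult A)
    also have "\<dots> = n powr real (2 * b) * J (K + K) k A"
      using pw[of "2 * b"] by (simp add: n_def)
    finally have "n powr (real (4 * K) - D - \<delta>) \<le> J (K + K) k A"
      using n1 by simp
    then have lower: "real (card A) ^ (4 * K) / (L * Q) \<le> J (K + K) k A"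
      unfolding n_def[symmetric] pw L_def Q_def by (simp add: powr_diff mult.commute)
    obtain A' where A': "A' \<subseteq> A" "n \<le> 16 * L ^ 2 * card A'"
      and sums: "\<And>l. real (card (iterated_sumset l (moment_curve k A'))) \<le> (2 ^ 40 * L ^ 28) ^ l * (2 ^ 33 * L ^ 23 * Q)"
      using small_iterated_sumsets[OF A(1,2) K1 L1 Q0 upper lower] unfolding n_def by blast
    \<comment> \<open>Absorbing 16 gives n \<le> L^3 |A'|, the source of the exponent 1 - 3
      \<delta>.\<close>
    have "16 * L ^ 2 * card A' \<le> L * L ^ 2 * card A'"
      using big by (intro mult_right_mono) auto
    with A'(2) have "n \<le> L ^ 3 * card A'" by (simp add: power3_eq_cube power2_eq_square)
    moreover have L3: "L ^ m = n powr (m * \<delta>)" for m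
      using n1 by (simp add: L_def powr_powr powr_realpow[symmetric] mult.commute)
    ultimately have "n powr 1 \<le> card A' * n powr (3 * \<delta>)"
      using n1 L3[of 3] by (simp add: mult.commute)
    moreover have "n powr (3 * \<delta>) > 0" using n1 by simp
    ultimately have "n powr 1 / n powr (3 * \<delta>) \<le> card A'"
      by (simp only: pos_divide_le_eq)
    then have cA': "n powr (1 - 3 * \<delta>) \<le> card A'" by (simp only: powr_diff)
    have "3 * \<delta> \<le> \<epsilon> * D" using eps D by (simp add: \<delta>_def)
    also have "\<dots> \<le> \<epsilon> * real k ^ 2" using eps Dk by simp
    finally have dk: "3 * \<delta> \<le> \<epsilon> * real k ^ 2" .
    have "\<alpha> powr (\<epsilon> / 4) * n powr (1 - \<epsilon> * real k ^ 2) \<le> 1 * n powr (1 - 3 * \<delta>)"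
      using alpha eps n1 dk by (intro mult_mono powr_mono powr_le1) auto
    with cA' have first: "\<alpha> powr (\<epsilon> / 4) * real (card A) powr (1 - \<epsilon> * real k ^ 2) \<le> real (card A')"
      by (simp add: n_def)
    have "real (card (iterated_sumset l (moment_curve k A'))) \<le>
           \<alpha> powr (- (1 + 2 * \<epsilon> * (real l + real k ^ 2))) *
           real (card A') powr (D * (1 + \<epsilon> * (real l + real k ^ 2)))" if l: "1 \<le> l" for l
    proof -
      have "real (card (iterated_sumset l (moment_curve k A'))) \<le> (2 ^ 40 * L ^ 28) ^ l * (2 ^ 33 * L ^ 23 * Q)"
        by (rule sums)
      also have "\<dots> \<le> (L * L ^ 28) ^ l * (L * L ^ 23 * Q)"
        using big L1 Q0 by (intro mult_mono power_mono) auto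
      also have "\<dots> = (L ^ 29) ^ l * (L ^ 24 * Q)"
        by (simp flip: power_Suc)
      also have "\<dots> = n powr (29 * \<delta> * real l + (24 * \<delta> + D))"
        unfolding power_mult[symmetric]
        unfolding L3 Q_def powr_add[symmetric] by (simp add: mult_ac)
      \<comment> \<open>The slack in \<open>exponent_le\<close> pays for replacing the power of n by
        a power of |A'|.\<close>
      also have "\<dots> \<le> n powr ((1 - 3 * \<delta>) * (D * (1 + \<epsilon> * (real l + real k ^ 2))))"
        using n1 exponent_le[OF D Dk eps, of "real l"] l unfolding \<delta>_def by (intro powr_mono) auto
      also have "\<dots> = (n powr (1 - 3 * \<delta>)) powr (D * (1 + \<epsilon> * (real l + real k ^ 2)))"
        by (simp add: powr_powr)
      also have "\<dots> \<le> real (card A') powr (D * (1 + \<epsilon> * (real l + real k ^ 2)))"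
        using cA' D eps by (intro powr_mono2) auto
      \<comment> \<open>Since \<alpha> \<le> 1 and the exponent is negative, the new factor is at
        least 1.\<close>
      also have "\<dots> \<le> \<alpha> powr (- (1 + 2 * \<epsilon> * (real l + real k ^ 2))) * \<dots>"
      proof -
        have E0: "0 \<le> 2 * \<epsilon> * (real l + real k ^ 2)" using eps by simp
        have "\<alpha> powr 0 \<le> \<alpha> powr (- (1 + 2 * \<epsilon> * (real l + real k ^ 2)))"
          using alpha E0 by (intro powr_mono') auto
        then have "1 * real (card A') powr (D * (1 + \<epsilon> * (real l + real k ^ 2))) \<le>
            \<alpha> powr (- (1 + 2 * \<epsilon> * (real l + real k ^ 2))) * real (card A') powr (D * (1 + \<epsilon> * (real l + real k ^ 2)))"
          using alpha by (intro mult_right_mono) auto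
        then show ?thesis by simp
      qed
      finally show ?thesis .
    qed
    then show "\<exists>A' \<subseteq> A. real (card A') \<ge> \<alpha> powr (\<epsilon> / 4) * real (card A) powr (1 - \<epsilon> * real k ^ 2) \<and>
        (\<forall>l :: nat. 1 \<le> l \<longrightarrow> real (card (iterated_sumset l (moment_curve k A'))) \<le>
           \<alpha> powr (- (1 + 2 * \<epsilon> * (real l + real k ^ 2))) *
           real (card A') powr (D * (1 + \<epsilon> * (real l + real k ^ 2))))"
      using A'(1) first by blast
  qed
qed

theorem theorem6p1:
  fixes s k :: nat
  assumes "1 \<le> s" and "1 \<le> k" and "s \<ge> k * (k + 1)"
  shows "\<exists>\<epsilon>\<^sub>0 > 0. \<forall>\<epsilon> :: real. 0 < \<epsilon> \<and> \<epsilon> < \<epsilon>\<^sub>0 \<longrightarrow>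
    (\<exists>N :: nat. \<forall>A :: int set. finite A \<and> A \<noteq> {} \<and> N \<le> card A \<longrightarrow>
      (\<forall>\<alpha> :: real. 0 < \<alpha> \<and> \<alpha> \<le> 1 \<and>
         ereal (ln (inverse \<alpha>)) \<le>
           ereal \<epsilon> * (ereal (real k * (real k + 1)) - 2 * Lambda) / 43200 * ereal (ln (real (card A))) \<and>
         real (J s k A) =
           \<alpha> * real (card A) powr (2 * real s - real k * (real k + 1) / 2 + real_of_ereal Lambda) \<longrightarrow>
         (\<exists>A' \<subseteq> A.
            real (card A') \<ge> \<alpha> powr (\<epsilon> / 4) * real (card A) powr (1 - \<epsilon> * real k ^ 2) \<and>
            (\<forall>l :: nat. 1 \<le> l \<longrightarrow>
               real (card (iterated_sumset l (moment_curve k A'))) \<le>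
                 \<alpha> powr (- (1 + 2 * \<epsilon> * (real l + real k ^ 2))) *
                 real (card A') powr
                   ((real k * (real k + 1) / 2 - real_of_ereal Lambda) * (1 + \<epsilon> * (real l + real k ^ 2)))))))"
\<comment> \<open>The threshold 1 / k^2 secures \<epsilon> k^2 \<le> 1, the smallness used in
  \<open>exponent_le\<close>.\<close>
proof (intro exI[of _ "1 / real k ^ 2"] conjI allI impI)
  show "0 < 1 / real k ^ 2" using assms by simp
  fix \<epsilon> :: real
  assume eps: "0 < \<epsilon> \<and> \<epsilon> < 1 / real k ^ 2"
  let ?hyp = "\<lambda>A \<alpha>. ereal (ln (inverse \<alpha>)) \<le>
           ereal \<epsilon> * (ereal (real k * (real k + 1)) - 2 * Lambda) / 43200 * ereal (ln (real (card (A :: int set))))"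
  let ?JA = "\<lambda>A \<alpha>. real (J s k A) =
      \<alpha> * real (card A) powr (2 * real s - real k * (real k + 1) / 2 + real_of_ereal Lambda)"
  let ?concl = "\<lambda>A \<alpha>. \<exists>A' \<subseteq> A.
            real (card A') \<ge> \<alpha> powr (\<epsilon> / 4) * real (card A) powr (1 - \<epsilon> * real k ^ 2) \<and>
            (\<forall>l :: nat. 1 \<le> l \<longrightarrow>
               real (card (iterated_sumset l (moment_curve k A'))) \<le>
                 \<alpha> powr (- (1 + 2 * \<epsilon> * (real l + real k ^ 2))) *
                 real (card A') powr
                   ((real k * (real k + 1) / 2 - real_of_ereal Lambda) * (1 + \<epsilon> * (real l + real k ^ 2))))"
  show "\<exists>N :: nat. \<forall>A :: int set. finite A \<and> A \<noteq> {} \<and> N \<le> card A \<longrightarrow>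
      (\<forall>\<alpha> :: real. 0 < \<alpha> \<and> \<alpha> \<le> 1 \<and> ?hyp A \<alpha> \<and> ?JA A \<alpha> \<longrightarrow> ?concl A \<alpha>)"
  proof (cases Lambda)
    case PInf
    \<comment> \<open>The right side of the hypothesis is minus infinity once ln |A| > 0, so the
      claim is vacuous from size 2 on.\<close>
    have "\<not> ?hyp A \<alpha>" if "2 \<le> card A" for A \<alpha>
    proof -
      have "0 < ln (real (card A))" using that by simp
      then show ?thesis using eps by (simp add: PInf numeral_eq_ereal divide_ereal_def)
    qed
    then show ?thesis by blast
  next
    case MInf
    then show ?thesis using Lambda_nonneg by simp
  next
    case (real lam)
    define D where "D = real k * (real k + 1) / 2 - lam"
    \<comment> \<open>As k (k + 1) - 2 \<Lambda> = 2 D, the divisor 43200 becomes 21600.\<close>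
    have hyp: "?hyp A \<alpha> \<longleftrightarrow> ln (inverse \<alpha>) \<le> \<epsilon> * D / 21600 * ln (real (card A))" for A \<alpha>
    proof -
      have "ereal \<epsilon> * (ereal (real k * (real k + 1)) - 2 * Lambda) / 43200 * ereal (ln (real (card A)))
          = ereal (\<epsilon> * D / 21600 * ln (real (card A)))"
        by (simp add: real numeral_eq_ereal D_def field_simps)
      then show ?thesis by (simp only: ereal_less_eq)
    qed
    have ek: "\<epsilon> * real k ^ 2 \<le> 1" using eps assms by (simp add: field_simps)
    show ?thesis
    proof (cases "D > 0")
      case True
      have "2 * real s - real k * (real k + 1) / 2 + real_of_ereal Lambda = 2 * real s - D"
        by (simp add: D_def real)
      then have JA: "?JA A \<alpha> \<longleftrightarrow> real (J s k A) = \<alpha> * real (card A) powr (2 * real s - D)" for A \<alpha>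
        by (simp only:)
      have DL: "real k * (real k + 1) / 2 - real_of_ereal Lambda = D"
        by (simp add: D_def real)
      show ?thesis
        unfolding hyp JA DL
        by (rule theorem6p1_finite_Lambda[OF assms real conjunct1[OF eps] ek True[unfolded D_def], folded D_def])
    next
      case False
      \<comment> \<open>A non-positive \<open>D\<close> forces \<alpha> = 1, whence J = |A|^(2 s -
        D) \<ge> |A|^(2 s), against \<open>J_less\<close>.\<close>
      have False if A: "finite A" "2 \<le> card A" "0 < \<alpha>" "\<alpha> \<le> 1" and h: "?hyp A \<alpha>"
        and JA: "?JA A \<alpha>"
        for A \<alpha>
      proof -
        have "\<epsilon> * D \<le> 0" using False eps by (intro mult_nonneg_nonpos) auto
        then have "\<epsilon> * D / 21600 * ln (real (card A)) \<le> 0"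
          using A by (intro mult_nonpos_nonneg) auto
        then have "ln (inverse \<alpha>) \<le> 0" using h hyp by fastforce
        then have "\<alpha> = 1" using A by (simp add: ln_inverse)
        then have "real (J s k A) = real (card A) powr (2 * real s - D)"
          using JA by (simp add: D_def real algebra_simps)
        also have "\<dots> \<ge> real (card A) powr (2 * real s)"
          using A False by (intro powr_mono) auto
        also have "real (card A) powr (2 * real s) = real (card A ^ (2 * s))"
          using A powr_realpow[of "real (card A)" "2 * s"] by simp
        finally show False
          using J_less[OF A(1,2) assms(1,2)] by simp
      qed
      then show ?thesis by blast
    qed
  qed
qed

end
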